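(* Let $a\ge b>0$ and $0\le t\le \frac12$. Then $$1\le \exp\left(\left(\frac{b-a}{(1-t)a+tb}-\log\frac{b}{a}\right)t\right)\le \frac{(1-t)a+tb}{a^{1-t}b^t},$$ which refines Young's inequality $a^{1-t}b^t\le(1-t)a+tb$ for such $a,b,t$. *)

theory Defs
  imports Complex_Main
begin

end

(*
  Put m = (1 - t) a + t b.  Since t (b - a) = m - a, the upper bound is, after taking logarithms,
  just ln (a / m) <= a / m - 1 (the tangent line of the concave function ln m at t, evaluated at 0).
  For the lower bound, t <= 1/2 gives m >= (a + b) / 2, so (a - b) / m <= 2 (a - b) / (a + b),
  which is at most ln (a / b) because the logarithmic mean is at most the arithmetic mean.
*)
theory Submission
  imports Defs
begin

text \<open>The difference of the two sides vanishes at 1, and its derivative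
  \<open>1 / y - 4 / (y + 1)^2\<close> equals \<open>(y - 1)^2 / (y * (y + 1)^2)\<close>, hence is
  nonnegative. At \<open>x = a / b\<close> this is the comparison of the logarithmic and arithmetic
  means.\<close>

lemma ln_ge_two_mult_diff_divide_sum:
  fixes x :: real
  assumes "1 \<le> x"
  shows "2 * (x - 1) / (x + 1) \<le> ln x"
proof -
  let ?g = "\<lambda>x::real. ln x - 2 * (x - 1) / (x + 1)"
  have "?g 1 \<le> ?g x"
  proof (rule DERIV_nonneg_imp_nondecreasing[OF assms])
    fix y :: real
    assume y: "1 \<le> y" "y \<le> x"
    \<comment> \<open>The left side is the form in which the quotient rule delivers the derivative
      of the fraction.\<close>
    have "(2 * (y + 1) - 2 * (y - 1)) / ((y + 1) * (y + 1)) = 4 / (y + 1)\<^sup>2"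
      by (simp add: power2_eq_square)
    then have "(?g has_real_derivative (1 / y - 4 / (y + 1)\<^sup>2)) (at y)"
      using y by (auto intro!: derivative_eq_intros)
    moreover have "4 * y \<le> (y + 1)\<^sup>2"
      using zero_le_power2[of "y - 1"] by (simp add: power2_eq_square algebra_simps)
    then have "0 \<le> 1 / y - 4 / (y + 1)\<^sup>2"
      using y by (simp add: field_simps)
    ultimately show "\<exists>d. (?g has_real_derivative d) (at y) \<and> 0 \<le> d"
      by blast
  qed
  then show ?thesis by simp
qed

theorem mainTheorem8:
  fixes a b t :: real
  assumes "a \<ge> b" and "b > 0" and "0 \<le> t" and "t \<le> 1 / 2"
  shows "1 \<le> exp (((b - a) / ((1 - t) * a + t * b) - ln (b / a)) * t)
       \<and> exp (((b - a) / ((1 - t) * a + t * b) - ln (b / a)) * t)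
           \<le> ((1 - t) * a + t * b) / (a powr (1 - t) * b powr t)
       \<and> a powr (1 - t) * b powr t
           \<le> exp (((b - a) / ((1 - t) * a + t * b) - ln (b / a)) * t) * (a powr (1 - t) * b powr t)
       \<and> exp (((b - a) / ((1 - t) * a + t * b) - ln (b / a)) * t) * (a powr (1 - t) * b powr t)
           \<le> (1 - t) * a + t * b"
proof -
  define m where "m = (1 - t) * a + t * b"
  define E where "E = ((b - a) / m - ln (b / a)) * t"
  define G where "G = a powr (1 - t) * b powr t"
  have a: "a > 0" using assms by simp
  \<comment> \<open>This product is exactly \<open>m - (a + b) / 2\<close>.\<close>
  have "0 \<le> (1 / 2 - t) * (a - b)" using assms by simp
  then have m_ge: "m \<ge> (a + b) / 2" by (simp add: m_def field_simps)
  then have m: "m > 0" using a assms by simp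
  have G: "G > 0" using a assms by (simp add: G_def)
  have quot: "a / b - 1 = (a - b) / b" "a / b + 1 = (a + b) / b"
    using assms by (simp_all add: field_simps)
  have "(a - b) / m \<le> (a - b) / ((a + b) / 2)"
    using m_ge m a assms by (intro divide_left_mono) auto
  also have "\<dots> = 2 * (a / b - 1) / (a / b + 1)"
    using assms unfolding quot by simp
  also have "\<dots> \<le> ln (a / b)"
    using a assms by (intro ln_ge_two_mult_diff_divide_sum) simp
  also have "\<dots> = - ln (b / a)"
    using a assms by (simp add: ln_div)
  finally have "0 \<le> (b - a) / m - ln (b / a)"
    by (simp add: diff_divide_distrib)
  then have E_nonneg: "0 \<le> E" using assms by (simp add: E_def)
  have "ln (a / m) \<le> a / m - 1"
    using a m by (intro ln_le_minus_one) simp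
  moreover have "t * ((b - a) / m) = 1 - a / m"
    using m by (simp add: m_def field_simps)
  \<comment> \<open>Here \<open>E = 1 - a / m + t * (ln a - ln b)\<close>, and the tangent bound
    gives \<open>1 - a / m \<le> ln m - ln a\<close>.\<close>
  ultimately have "E \<le> ln m - ((1 - t) * ln a + t * ln b)"
    using a m assms by (simp add: E_def ln_div algebra_simps)
  also have "\<dots> = ln (m / G)"
    using a m assms by (simp add: G_def ln_div ln_mult ln_powr)
  finally have E_le: "exp E \<le> m / G"
    using m G by (simp add: ln_ge_iff)
  have "1 \<le> exp E" using E_nonneg by simp
  \<comment> \<open>The last two conjuncts are the first two multiplied by
    \<open>G > 0\<close>.\<close>
  moreover from this have "G \<le> exp E * G" using G by simp
  moreover have "exp E * G \<le> m" using E_le G by (simp add: field_simps)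
  ultimately show ?thesis using E_le unfolding E_def G_def m_def by blast
qed

end
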